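(* Let $x \in [-1,1]\setminus \mathbb{Q}$. For each $\omega\in\Omega$, the digits $d_n(\omega,x)$, $n\ge 1$, give a continued fraction expansion of $x$, i.e. $$x = \cfrac{(-1)^{\omega_0}}{d_1 + \cfrac{(-1)^{\omega_1}}{d_2 + \cfrac{(-1)^{\omega_2}}{d_3+\ddots}}},\qquad d_n=d_n(\omega,x),$$ meaning that all $d_n$ are finite and $\lim_{n\to\infty} p_n/q_n = x$.
   Context: $\Omega=\{0,1\}^{\mathbb{N}}$ is the set of sequences $\omega=(\omega_k)_{k\ge1}$ with $\omega_k\in\{0,1\}$, and $\sigma$ is the left shift on $\Omega$. The random continued fraction map $K:\Omega\times[-1,1]\to\Omega\times[-1,1]$ is given by $K(\omega,0)=(\sigma(\omega),0)$ and, for $|x|\in(\frac1{k+1},\frac1k]$ with $k\in\mathbb{N}=\{1,2,\dots\}$, $$K(\omega,x)=\Big(\sigma(\omega),\ \Big|\frac1x\Big|-(k+\omega_1)\Big).$$ Given $(\omega,x)$, set $\omega_0=0$ if $x\ge 0$ and $\omega_0=1$ if $x<0$. Digits: $d_1(\omega,x)=k+\omega_1$ if $|x|\in(\frac1{k+1},\frac1k]$, $d_1(\omega,x)=\infty$ if $x=0$, and $d_n(\omega,x)=d_1(K^{n-1}(\omega,x))$ for $n\ge2$. The convergents are the truncations $$\frac{p_n}{q_n} = \cfrac{(-1)^{\omega_0}}{d_1 + \cfrac{(-1)^{\omega_1}}{d_2 + \ddots + \cfrac{(-1)^{\omega_{n-1}}}{d_n}}},$$ with $p_n,q_n$ given by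 $p_{-1}=1$, $p_0=0$, $p_n=d_np_{n-1}+(-1)^{\omega_{n-1}}p_{n-2}$ and $q_{-1}=0$, $q_0=1$, $q_n=d_nq_{n-1}+(-1)^{\omega_{n-1}}q_{n-2}$ for $n\ge1$. *)

theory Defs
  imports Complex_Main "HOL-Library.FuncSet" "HOL-Library.Extended_Nat"
begin

text \<open>
  The binary sequences are indexed from 1. They are taken extensional on \<open>{1..}\<close>, so the
  value at 0 carries no information.
\<close>

definition Omega :: "(nat \<Rightarrow> nat) set" where
  "Omega = (\<Pi>\<^sub>E k\<in>{1..}. {0, 1})"

definition shift :: "(nat \<Rightarrow> nat) \<Rightarrow> nat \<Rightarrow> nat" where
  "shift \<omega> = (\<lambda>k\<in>{1..}. \<omega> (k + 1))"

lemma shift_in_Omega: "\<omega> \<in> Omega \<Longrightarrow> shift \<omega> \<in> Omega"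
  by (auto simp: Omega_def shift_def PiE_def Pi_def extensional_def)

definition branch :: "real \<Rightarrow> nat" where
  "branch x = (THE k. k \<ge> 1 \<and> \<bar>x\<bar> \<in> {1 / (real k + 1)<..1 / real k})"

lemma branch_unique:
  assumes "x \<in> {-1..1}" "x \<noteq> 0"
  shows "\<exists>!k. k \<ge> 1 \<and> \<bar>x\<bar> \<in> {1 / (real k + 1)<..1 / real k}"
proof -
  have x: "0 < \<bar>x\<bar>" "1 \<le> 1 / \<bar>x\<bar>"
    using assms by auto
  have eq: "k \<ge> 1 \<and> \<bar>x\<bar> \<in> {1 / (real k + 1)<..1 / real k} \<longleftrightarrow> k = nat \<lfloor>1 / \<bar>x\<bar>\<rfloor>" for k
  proof -
    have "\<lfloor>1 / \<bar>x\<bar>\<rfloor> \<ge> 1" using x(2) by linarith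
    have "k \<ge> 1 \<and> \<bar>x\<bar> \<in> {1 / (real k + 1)<..1 / real k}
        \<longleftrightarrow> k \<ge> 1 \<and> real k \<le> 1 / \<bar>x\<bar> \<and> 1 / \<bar>x\<bar> < real k + 1"
      using x(1) by (auto simp: field_simps)
    also have "\<dots> \<longleftrightarrow> k = nat \<lfloor>1 / \<bar>x\<bar>\<rfloor>"
      using \<open>\<lfloor>1 / \<bar>x\<bar>\<rfloor> \<ge> 1\<close> by linarith
    finally show ?thesis .
  qed
  show ?thesis unfolding eq by simp
qed

definition rcf_map :: "(nat \<Rightarrow> nat) \<times> real \<Rightarrow> (nat \<Rightarrow> nat) \<times> real" where
  "rcf_map = (\<lambda>(\<omega>, x). (shift \<omega>, if x = 0 then 0 else \<bar>1 / x\<bar> - real (branch x + \<omega> 1)))"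

definition digit1 :: "(nat \<Rightarrow> nat) \<times> real \<Rightarrow> enat" where
  "digit1 = (\<lambda>(\<omega>, x). if x = 0 then \<infinity> else enat (branch x + \<omega> 1))"

text \<open>Meaningful for \<open>n \<ge> 1\<close> only.\<close>

definition digit :: "(nat \<Rightarrow> nat) \<Rightarrow> real \<Rightarrow> nat \<Rightarrow> enat" where
  "digit \<omega> x n = digit1 ((rcf_map ^^ (n - 1)) (\<omega>, x))"

text \<open>
  The sign exponents \<open>\<omega>\<^sub>0, \<omega>\<^sub>1, \<dots>\<close>, where \<open>\<omega>\<^sub>0\<close> is determined by \<open>x\<close>
  rather than by the sequence \<open>\<omega>\<close>.
\<close>

definition sign_exp :: "(nat \<Rightarrow> nat) \<Rightarrow> real \<Rightarrow> nat \<Rightarrow> nat" where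
  "sign_exp \<omega> x n = (if n = 0 then (if x \<ge> 0 then 0 else 1) else \<omega> n)"

text \<open>
  The three-term recurrence \<open>r\<^sub>n = b\<^sub>n r\<^sub>n\<^sub>-\<^sub>1 + a\<^sub>n\<^sub>-\<^sub>1 r\<^sub>n\<^sub>-\<^sub>2\<close> with initial values
  \<open>r\<^sub>-\<^sub>1 = u\<close> and \<open>r\<^sub>0 = v\<close>; the argument is shifted by one, so
  \<open>cf_rec a b u v (Suc n)\<close> is \<open>r\<^sub>n\<close>.
\<close>

fun cf_rec :: "(nat \<Rightarrow> int) \<Rightarrow> (nat \<Rightarrow> int) \<Rightarrow> int \<Rightarrow> int \<Rightarrow> nat \<Rightarrow> int" where
  "cf_rec a b u v 0 = u"
| "cf_rec a b u v (Suc 0) = v"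
| "cf_rec a b u v (Suc (Suc n)) =
     b (Suc n) * cf_rec a b u v (Suc n) + a n * cf_rec a b u v n"

definition cf_num :: "(nat \<Rightarrow> nat) \<Rightarrow> real \<Rightarrow> nat \<Rightarrow> int" where
  "cf_num \<omega> x n =
     cf_rec (\<lambda>i. (-1) ^ sign_exp \<omega> x i) (\<lambda>i. int (the_enat (digit \<omega> x i))) 1 0 (Suc n)"

definition cf_den :: "(nat \<Rightarrow> nat) \<Rightarrow> real \<Rightarrow> nat \<Rightarrow> int" where
  "cf_den \<omega> x n =
     cf_rec (\<lambda>i. (-1) ^ sign_exp \<omega> x i) (\<lambda>i. int (the_enat (digit \<omega> x i))) 0 1 (Suc n)"

text \<open>
  \<open>cf_trunc a b i m\<close> is the finite fraction
  \<open>a\<^sub>i / (b\<^sub>i\<^sub>+\<^sub>1 + a\<^sub>i\<^sub>+\<^sub>1 / (b\<^sub>i\<^sub>+\<^sub>2 + \<dots> + a\<^sub>i\<^sub>+\<^sub>m\<^sub>-\<^sub>1 / b\<^sub>i\<^sub>+\<^sub>m))\<close>. The lemma below shows that the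
  quotients \<open>cf_num \<omega> x n / cf_den \<omega> x n\<close> are the truncated continued fractions as long as no
  division by zero occurs in them.
\<close>

fun cf_trunc :: "(nat \<Rightarrow> int) \<Rightarrow> (nat \<Rightarrow> int) \<Rightarrow> nat \<Rightarrow> nat \<Rightarrow> real" where
  "cf_trunc a b i 0 = 0"
| "cf_trunc a b i (Suc m) = real_of_int (a i) / (real_of_int (b (Suc i)) + cf_trunc a b (Suc i) m)"

lemma cf_trunc_eq:
  assumes "\<And>i. i < n \<Longrightarrow> real_of_int (b (Suc i)) + cf_trunc a b (Suc i) (n - Suc i) \<noteq> 0"
  shows "cf_trunc a b 0 n = real_of_int (cf_rec a b 1 0 (Suc n)) / real_of_int (cf_rec a b 0 1 (Suc n))"
proof -
  let ?r = "\<lambda>u v k. real_of_int (cf_rec a b u v k)"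
  have "cf_trunc a b 0 n =
      (?r 1 0 (Suc i) + cf_trunc a b i (n - i) * ?r 1 0 i) /
      (?r 0 1 (Suc i) + cf_trunc a b i (n - i) * ?r 0 1 i)" if "i \<le> n" for i
    using that
  proof (induction i)
    case 0
    then show ?case by simp
  next
    case (Suc i)
    define t where "t = cf_trunc a b (Suc i) (n - Suc i)"
    define c where "c = real_of_int (b (Suc i)) + t"
    have c: "c \<noteq> 0" using assms[of i] Suc.prems by (simp add: c_def t_def)
    have "n - i = Suc (n - Suc i)" using Suc.prems by simp
    then have s: "cf_trunc a b i (n - i) = real_of_int (a i) / c"
      by (simp add: c_def t_def)
    have step: "?r u v (Suc i) + real_of_int (a i) / c * ?r u v i =
        (?r u v (Suc (Suc i)) + t * ?r u v (Suc i)) / c" for u v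
      using c by (simp add: field_simps c_def)
    show ?case
      using Suc c unfolding s step t_def by simp
  qed
  from this[of n] show ?thesis by simp
qed

end

theory Submission
  imports Defs
begin

text \<open>
  Write \<open>y\<^sub>n\<close> for the orbit of \<open>x\<close> and \<open>a\<^sub>n = (-1)\<^bsup>\<omega>\<^sub>n\<^esup>\<close>, so that \<open>y\<^sub>n = a\<^sub>n / (d\<^sub>n\<^sub>+\<^sub>1 + y\<^sub>n\<^sub>+\<^sub>1)\<close> and
  \<open>y\<^sub>n = a\<^sub>n \<bar>y\<^sub>n\<bar>\<close>. The denominators \<open>q\<^sub>n\<close> need not be monotone, but
  \<open>d\<^sub>n + a\<^sub>n \<ge> 1\<close> makes the integers \<open>s\<^sub>n = q\<^sub>n + a\<^sub>n q\<^sub>n\<^sub>-\<^sub>1\<close> positive and nondecreasing, and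
  \<open>q\<^sub>n\<^sub>+\<^sub>1 \<ge> s\<^sub>n\<close>. Since \<open>q\<^sub>n + y\<^sub>n q\<^sub>n\<^sub>-\<^sub>1\<close> is the convex combination
  \<open>(1 - \<bar>y\<^sub>n\<bar>) q\<^sub>n + \<bar>y\<^sub>n\<bar> s\<^sub>n\<close>, the error of the \<open>n\<close>-th convergent is at most \<open>1 / s\<^sub>n\<close>. If \<open>s\<^sub>n\<close>
  were bounded, then eventually \<open>d\<^sub>n = 2\<close> and \<open>a\<^sub>n = -1\<close>, and \<open>1 / (1 + y\<^sub>n)\<close> would decrease
  by 1 in every step while staying positive.
\<close>

text \<open>One step of the recurrence multiplies the determinant by \<open>- a n\<close>, a unit,
  and its initial value is 1.\<close>

lemma cf_rec_det:
  assumes "\<And>n. \<bar>a n\<bar> = 1"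
  shows "\<bar>cf_rec a b 1 0 (Suc n) * cf_rec a b 0 1 n - cf_rec a b 1 0 n * cf_rec a b 0 1 (Suc n)\<bar> = 1"
proof (induction n)
  case (Suc n)
  have "cf_rec a b 1 0 (Suc (Suc n)) * cf_rec a b 0 1 (Suc n) -
      cf_rec a b 1 0 (Suc n) * cf_rec a b 0 1 (Suc (Suc n)) =
      - a n * (cf_rec a b 1 0 (Suc n) * cf_rec a b 0 1 n - cf_rec a b 1 0 n * cf_rec a b 0 1 (Suc n))"
    by (simp add: algebra_simps)
  then show ?case using Suc assms[of n] by (simp only: abs_mult abs_minus_cancel)
qed simp

text \<open>The step from \<open>n\<close> to \<open>Suc n\<close> multiplies both sides by the same
  factor \<open>c\<close>. Thus inserting the exact remainder \<open>y n\<close> after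
  \<open>n\<close> digits recovers \<open>y 0\<close>.\<close>

lemma cf_rec_tail:
  fixes y :: "nat \<Rightarrow> real"
  assumes "\<And>n. y n * (real_of_int (b (Suc n)) + y (Suc n)) = real_of_int (a n)"
  shows "y 0 * (real_of_int (cf_rec a b 0 1 (Suc n)) + y n * real_of_int (cf_rec a b 0 1 n)) =
    real_of_int (cf_rec a b 1 0 (Suc n)) + y n * real_of_int (cf_rec a b 1 0 n)"
proof (induction n)
  case (Suc n)
  define c where "c = real_of_int (b (Suc n)) + y (Suc n)"
  have step: "real_of_int (cf_rec a b u v (Suc (Suc n))) + y (Suc n) * real_of_int (cf_rec a b u v (Suc n)) =
      c * (real_of_int (cf_rec a b u v (Suc n)) + y n * real_of_int (cf_rec a b u v n))" for u v
    by (simp add: c_def distrib_left distrib_right flip: assms)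
  show ?case
    unfolding step by (simp only: Suc.IH[symmetric] mult.left_commute)
qed simp

text \<open>Integrality turns every strict increase into a gain of at least 1.\<close>

lemma mono_int_at_top:
  fixes s :: "nat \<Rightarrow> int"
  assumes "mono s" and freq: "\<And>N. \<exists>n\<ge>N. s n < s (Suc n)"
  shows "filterlim s at_top sequentially"
proof -
  have unbounded: "\<exists>n. s 0 + int k \<le> s n" for k
  proof (induction k)
    case (Suc k)
    then obtain m where m: "s 0 + int k \<le> s m" by blast
    obtain n where n: "n \<ge> m" "s n < s (Suc n)" using freq by blast
    have "s m \<le> s n" using \<open>mono s\<close> n(1) by (simp add: monoD)
    with m n(2) have "s 0 + int (Suc k) \<le> s (Suc n)" by simp
    then show ?case by blast
  qed auto
  show ?thesis
    unfolding filterlim_at_top eventually_sequentially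
  proof
    fix Z
    obtain n where "s 0 + int (nat (Z - s 0)) \<le> s n" using unbounded by blast
    then have "Z \<le> s n" by linarith
    then show "\<exists>N. \<forall>n\<ge>N. Z \<le> s n" using \<open>mono s\<close> by (meson monoD order_trans)
  qed
qed

text \<open>The map taking \<open>y n\<close> to \<open>y (Suc n)\<close> has -1 as a parabolic
  fixed point; the coordinate \<open>1 / (1 + y)\<close> sends it to infinity and turns the map into
  a translation.\<close>

lemma not_eventually_parabolic:
  fixes y :: "nat \<Rightarrow> real"
  assumes step: "\<And>n. n \<ge> N \<Longrightarrow> y n * (2 + y (Suc n)) = -1"
    and gt: "\<And>n. n \<ge> N \<Longrightarrow> -1 < y n"
  shows False
proof -
  have "1 / (1 + y (N + k)) = 1 / (1 + y N) - real k" for k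
  proof (induction k)
    case (Suc k)
    have pos: "1 + y (N + k) > 0" "1 + y (Suc (N + k)) > 0"
      using gt[of "N + k"] gt[of "Suc (N + k)"] by auto
    have "(1 + y (N + k)) * (2 + y (Suc (N + k))) = 1 + y (Suc (N + k))"
      using step[of "N + k"] by (simp add: algebra_simps)
    then have "1 / (1 + y (N + k)) = 1 + 1 / (1 + y (Suc (N + k)))"
      using pos by (simp add: field_simps)
    then show ?case using Suc by simp
  qed simp
  moreover have "1 / (1 + y (N + k)) > 0" for k using gt[of "N + k"] by simp
  moreover obtain k where "1 / (1 + y N) < real k" using reals_Archimedean2 by blast
  ultimately show False by (metis diff_less_0_iff_less less_asym)
qed

text \<open>This separates the convergence argument from the random map. By \<open>ba_ge\<close>, a
  digit followed by a minus sign is at least 2.\<close>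

lemma cf_convergents_tendsto:
  fixes y :: "nat \<Rightarrow> real"
  assumes step: "\<And>n. y n * (real_of_int (b (Suc n)) + y (Suc n)) = real_of_int (a n)"
    and a: "\<And>n. \<bar>a n\<bar> = 1"
    and y_sign: "\<And>n. y n = real_of_int (a n) * \<bar>y n\<bar>"
    and y_bound: "\<And>n. \<bar>y n\<bar> < 1"
    and b_ge: "\<And>n. b (Suc n) \<ge> 1"
    and ba_ge: "\<And>n. b (Suc n) + a (Suc n) \<ge> 1"
  shows "(\<lambda>n. real_of_int (cf_rec a b 1 0 (Suc n)) / real_of_int (cf_rec a b 0 1 (Suc n)))
    \<longlonglongrightarrow> y 0"
proof -
  define p where "p = cf_rec a b 1 0"
  define q where "q = cf_rec a b 0 1"
  \<comment> \<open>\<open>cf_rec\<close> is shifted by one, so \<open>q (Suc n)\<close> is the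
    denominator with index \<open>n\<close>.\<close>
  define s where "s n = q (Suc n) + a n * q n" for n
  have q_rec: "q (Suc (Suc n)) = b (Suc n) * q (Suc n) + a n * q n" for n
    by (simp add: q_def)
  have s_diff: "s (Suc n) = s n + (b (Suc n) + a (Suc n) - 1) * q (Suc n)" for n
    by (simp add: s_def q_rec algebra_simps)
  have q_diff: "q (Suc (Suc n)) = s n + (b (Suc n) - 1) * q (Suc n)" for n
    by (simp add: s_def q_rec algebra_simps)
  \<comment> \<open>Joint induction: both successors arise from \<open>s n\<close> by adding a
    nonnegative multiple of \<open>q (Suc n)\<close>.\<close>
  have qs_pos: "q (Suc n) \<ge> 1 \<and> s n \<ge> 1" for n
  proof (induction n)
    case (Suc n)
    have "(b (Suc n) + a (Suc n) - 1) * q (Suc n) \<ge> 0" "(b (Suc n) - 1) * q (Suc n) \<ge> 0"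
      using Suc ba_ge[of n] b_ge[of n] by auto
    then show ?case using Suc s_diff[of n] q_diff[of n] by linarith
  qed (simp add: s_def q_def)
  have "s n \<le> s (Suc n)" for n
    using qs_pos[of n] ba_ge[of n] by (simp add: s_diff)
  then have "mono s" by (simp add: mono_iff_le_Suc)
  moreover have "\<exists>n\<ge>N. s n < s (Suc n)" for N
  proof (rule ccontr)
    assume "\<not> (\<exists>n\<ge>N. s n < s (Suc n))"
    then have "(b (Suc n) + a (Suc n) - 1) * q (Suc n) \<le> 0" if "n \<ge> N" for n
      using that s_diff[of n] by force
    then have ba: "b (Suc n) + a (Suc n) = 1" if "n \<ge> N" for n
      using that qs_pos[of n] ba_ge[of n] by (smt (verit) mult_pos_pos)
    have ab: "a (Suc n) = -1 \<and> b (Suc n) = 2" if "n \<ge> N" for n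
      using ba[OF that] a[of "Suc n"] b_ge[of n] by linarith
    \<comment> \<open>The start moves to \<open>Suc N\<close> because \<open>ab\<close> controls
      \<open>a\<close> only from index \<open>Suc N\<close> on.\<close>
    have "y n * (2 + y (Suc n)) = -1" if n: "n \<ge> Suc N" for n
    proof -
      obtain m where m: "n = Suc m" "m \<ge> N" using n by (cases n) auto
      show ?thesis using step[of n] ab[of n] ab[of m] m by simp
    qed
    moreover have "-1 < y n" for n using y_bound[of n] by linarith
    ultimately show False using not_eventually_parabolic[of "Suc N" y] by blast
  qed
  ultimately have "filterlim s at_top sequentially" by (rule mono_int_at_top)
  then have s_lim: "(\<lambda>n. 1 / real_of_int (s n)) \<longlonglongrightarrow> 0"
    by (intro tendsto_divide_0[OF tendsto_const] filterlim_at_top_imp_at_infinity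
        filterlim_compose[OF filterlim_real_of_int_at_top])
  have "norm (real_of_int (p (Suc n)) / real_of_int (q (Suc n)) - y 0)
      \<le> norm (1 / real_of_int (s n)) * 1" for n
  proof -
    define Q where "Q = real_of_int (q (Suc n))"
    define S where "S = real_of_int (s n)"
    define D where "D = Q + y n * real_of_int (q n)"
    have QS: "Q \<ge> 1" "S \<ge> 1" using qs_pos[of n] by (auto simp: Q_def S_def)
    define t where "t = \<bar>y n\<bar>"
    have yt: "y n = real_of_int (a n) * t" unfolding t_def by (rule y_sign)
    have "S = Q + real_of_int (a n) * real_of_int (q n)" by (simp add: S_def Q_def s_def)
    then have "D = (1 - t) * Q + t * S"
      unfolding D_def yt by (simp add: algebra_simps)
    then have "D = (1 - \<bar>y n\<bar>) * Q + \<bar>y n\<bar> * S" by (simp only: t_def)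
    moreover have "0 < (1 - \<bar>y n\<bar>) * Q" using y_bound[of n] QS by auto
    moreover have "0 \<le> \<bar>y n\<bar> * S" using QS by auto
    ultimately have D: "D > 0" "\<bar>y n\<bar> * S \<le> D" by linarith+
    have tail: "y 0 * D = real_of_int (p (Suc n)) + y n * real_of_int (p n)"
      unfolding D_def Q_def p_def q_def by (rule cf_rec_tail) (rule step)
    \<comment> \<open>Clearing denominators leaves \<open>y n\<close> times the determinant of
      \<open>cf_rec_det\<close>.\<close>
    have "(real_of_int (p (Suc n)) / Q - y 0) * (Q * D) =
        real_of_int (p (Suc n)) * D - Q * (y 0 * D)"
      using QS by (simp add: field_simps)
    also have "\<dots> = y n * real_of_int (p (Suc n) * q n - p n * q (Suc n))"
      unfolding tail by (simp add: D_def Q_def algebra_simps)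
    finally have "(real_of_int (p (Suc n)) / Q - y 0) * (Q * D) =
        y n * real_of_int (p (Suc n) * q n - p n * q (Suc n))" .
    moreover have "\<bar>real_of_int (p (Suc n) * q n - p n * q (Suc n))\<bar> = 1"
      using cf_rec_det[of a b n] a unfolding p_def q_def by (metis of_int_1 of_int_abs)
    ultimately have "\<bar>real_of_int (p (Suc n)) / Q - y 0\<bar> * (Q * D) = \<bar>y n\<bar>"
      using QS D by (metis abs_mult abs_of_pos less_le_trans mult.right_neutral mult_pos_pos zero_less_one)
    then have err: "\<bar>real_of_int (p (Suc n)) / Q - y 0\<bar> = \<bar>y n\<bar> / (Q * D)"
      using QS D by (simp add: field_simps)
    \<comment> \<open>The factor \<open>\<bar>y n\<bar>\<close> in the error offsets the one in the
      lower bound for \<open>D\<close>, so small \<open>y n\<close> does no harm.\<close>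
    have "\<bar>y n\<bar> * S \<le> Q * D"
      using D QS mult_right_mono[of 1 Q D] by linarith
    then have "\<bar>y n\<bar> / (Q * D) \<le> 1 / S"
      using D QS by (simp add: field_simps)
    with err QS show ?thesis by (simp add: Q_def S_def)
  qed
  then have "(\<lambda>n. real_of_int (p (Suc n)) / real_of_int (q (Suc n)) - y 0) \<longlonglongrightarrow> 0"
    by (intro tendsto_0_le[OF s_lim] always_eventually) blast
  then show ?thesis by (simp add: LIM_zero_iff p_def q_def)
qed

lemma branch_bounds:
  assumes "x \<in> {-1..1}" "x \<noteq> 0"
  shows "branch x \<ge> 1" "real (branch x) \<le> 1 / \<bar>x\<bar>" "1 / \<bar>x\<bar> < real (branch x) + 1"
proof -
  have k: "branch x \<ge> 1 \<and> \<bar>x\<bar> \<in> {1 / (real (branch x) + 1)<..1 / real (branch x)}"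
    unfolding branch_def by (rule theI') (rule branch_unique[OF assms])
  then show "branch x \<ge> 1" "real (branch x) \<le> 1 / \<bar>x\<bar>" "1 / \<bar>x\<bar> < real (branch x) + 1"
    using assms(2) by (auto simp: field_simps)
qed

text \<open>Index 0 is excluded because \<open>shift\<close> returns \<open>undefined\<close>
  there.\<close>

lemma fst_rcf_map_funpow:
  "k \<ge> 1 \<Longrightarrow> fst ((rcf_map ^^ n) (\<omega>, x)) k = \<omega> (n + k)"
  by (induction n arbitrary: k) (auto simp: rcf_map_def shift_def split_beta)

theorem proposition2p1:
  fixes x :: real and \<omega> :: "nat \<Rightarrow> nat"
  assumes "x \<in> {-1..1} - \<rat>"
    and "\<omega> \<in> Omega"
  shows "(\<forall>n\<ge>1. digit \<omega> x n \<noteq> \<infinity>) \<and>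
    (\<lambda>n. real_of_int (cf_num \<omega> x n) / real_of_int (cf_den \<omega> x n)) \<longlonglongrightarrow> x"
proof -
  have \<omega>: "\<omega> (Suc n) = 0 \<or> \<omega> (Suc n) = 1" for n
    using assms(2) by (auto simp: Omega_def PiE_def Pi_def)
  define y where "y n = snd ((rcf_map ^^ n) (\<omega>, x))" for n
  have y0: "y 0 = x" by (simp add: y_def)
  have y_Suc: "y (Suc n) = \<bar>1 / y n\<bar> - real (branch (y n) + \<omega> (Suc n))" if "y n \<noteq> 0" for n
    using that fst_rcf_map_funpow[of 1 n \<omega> x] by (simp add: y_def rcf_map_def split_beta)
  \<comment> \<open>Reciprocals and integer translations preserve irrationality, so the orbit never
    reaches 0.\<close>
  have y_range: "y n \<in> {-1..1} - \<rat>" for n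
  proof (induction n)
    case (Suc n)
    then have n0: "y n \<noteq> 0" by auto
    have "y (Suc n) \<in> {-1..1}"
      using branch_bounds[of "y n"] Suc n0 \<omega>[of n] y_Suc[OF n0] by (auto simp: abs_divide)
    moreover have "y (Suc n) \<notin> \<rat>"
    proof
      assume "y (Suc n) \<in> \<rat>"
      then have "y (Suc n) + real (branch (y n) + \<omega> (Suc n)) \<in> \<rat>" by (intro Rats_add Rats_of_nat)
      then have "\<bar>1 / y n\<bar> \<in> \<rat>" using y_Suc[OF n0] by simp
      then have "1 / y n \<in> \<rat>" by (simp add: abs_if split: if_splits)
      then have "1 / (1 / y n) \<in> \<rat>" by (rule Rats_divide[OF Rats_1])
      then show False using Suc by simp
    qed
    ultimately show ?case by blast
  qed (use assms(1) y0 in simp)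
  have y_nz: "y n \<noteq> 0" for n using y_range[of n] by auto
  have y_bound: "\<bar>y n\<bar> < 1" for n
  proof -
    have "y n \<noteq> 1" "y n \<noteq> -1" using y_range[of n] by auto
    then show ?thesis using y_range[of n] by auto
  qed
  have digit: "digit \<omega> x (Suc n) = enat (branch (y n) + \<omega> (Suc n))" for n
    using y_nz[of n] fst_rcf_map_funpow[of 1 n \<omega> x]
    by (simp add: digit_def digit1_def split_beta flip: y_def)
  define a :: "nat \<Rightarrow> int" where "a i = (-1) ^ sign_exp \<omega> x i" for i
  define b where "b i = int (the_enat (digit \<omega> x i))" for i
  have b_Suc: "b (Suc n) = int (branch (y n)) + int (\<omega> (Suc n))" for n
    by (simp add: b_def digit)
  have a_Suc: "a (Suc n) = (-1) ^ \<omega> (Suc n)" for n by (simp add: a_def sign_exp_def)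
  have br: "branch (y n) \<ge> 1" "real (branch (y n)) \<le> 1 / \<bar>y n\<bar>"
    "1 / \<bar>y n\<bar> < real (branch (y n)) + 1" for n
    using branch_bounds[of "y n"] y_range[of n] y_nz[of n] by auto
  \<comment> \<open>For \<open>n = Suc m\<close>, \<open>1 / \<bar>y m\<bar> - branch (y m)\<close>
    lies in [0, 1); subtracting \<open>\<omega> (Suc m)\<close> makes it negative exactly when
    \<open>a (Suc m) = -1\<close>.\<close>
  have y_sign: "y n = real_of_int (a n) * \<bar>y n\<bar>" for n
  proof (cases n)
    case 0
    then show ?thesis using y0 by (simp add: a_def sign_exp_def)
  next
    case (Suc m)
    then show ?thesis
      using \<omega>[of m] br[of m] y_Suc[OF y_nz[of m]] by (auto simp: a_Suc abs_divide)
  qed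
  have "(\<lambda>n. real_of_int (cf_rec a b 1 0 (Suc n)) / real_of_int (cf_rec a b 0 1 (Suc n)))
    \<longlonglongrightarrow> y 0"
  proof (rule cf_convergents_tendsto)
    fix n
    have "real_of_int (b (Suc n)) + y (Suc n) = 1 / \<bar>y n\<bar>"
      using y_Suc[OF y_nz[of n]] by (simp add: b_Suc abs_divide)
    moreover have "y n * (1 / \<bar>y n\<bar>) = real_of_int (a n)"
      using arg_cong[OF y_sign[of n], of "\<lambda>t. t * (1 / \<bar>y n\<bar>)"] y_nz[of n] by simp
    ultimately show "y n * (real_of_int (b (Suc n)) + y (Suc n)) = real_of_int (a n)"
      by (simp only:)
    show "\<bar>a n\<bar> = 1" by (simp add: a_def power_abs)
    show "b (Suc n) \<ge> 1" using br(1)[of n] by (simp add: b_Suc)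
    \<comment> \<open>The bit that makes the sign negative also raises the digit by 1.\<close>
    show "b (Suc n) + a (Suc n) \<ge> 1" using br(1)[of n] \<omega>[of n] by (auto simp: b_Suc a_Suc)
  qed (fact y_sign y_bound)+
  moreover have "digit \<omega> x n \<noteq> \<infinity>" if "n \<ge> 1" for n
    using that digit[of "n - 1"] by simp
  ultimately show ?thesis
    by (simp add: y0 cf_num_def cf_den_def a_def[abs_def] b_def[abs_def])
qed

end
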